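(* Whenever all the series concerned are either convergent or terminating, $$\sum_{m,n=0}^\infty\frac{(p,m+n)(p',m+n)(-1)^n x^{m+n}}{(p,m)(p',n)}L_m^{(p-1)}(-y)\,L_n^{(p'-1)}(y)={}_2F_1\!\left(\tfrac{p+p'-1}{2},\tfrac{p+p'}{2};\,p+p'-1;\,4xy\right)=(1-4xy)^{-1/2}\left[\tfrac12+\tfrac12(1-4xy)^{1/2}\right]^{2-p-p'}.$$
   Context: Here $p,p'$ are complex parameters and $x,y$ complex variables. $(\alpha,n)=\alpha(\alpha+1)\cdots(\alpha+n-1)$ for $n\ge1$ and $(\alpha,0)=1$ (Pochhammer symbol). ${}_2F_1(a,b;c;z)=\sum_{n\ge0}\frac{(a,n)(b,n)}{(c,n)}\frac{z^n}{n!}$. The Laguerre polynomial is $L_n^{(a)}(x)=\frac{(a+1,n)}{n!}\,{}_1F_1[-n;a+1;x]$, where ${}_1F_1[\alpha;\beta;z]=\sum_{k\ge0}\frac{(\alpha,k)}{(\beta,k)}\frac{z^k}{k!}$. *)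

theory Defs
  imports "HOL-Analysis.Analysis"
begin

text \<open>
  The symbol $(\alpha,n)$ is \<^term>\<open>pochhammer \<alpha> n\<close>.
  Division by zero is zero in HOL, so the definitions below are meaningful only for lower
  parameters outside \<^term>\<open>\<int>\<^sub>\<le>\<^sub>0\<close>.
\<close>

definition hyp1F1 :: "complex \<Rightarrow> complex \<Rightarrow> complex \<Rightarrow> complex" where
  "hyp1F1 \<alpha> \<beta> z = (\<Sum>k. pochhammer \<alpha> k / pochhammer \<beta> k * (z ^ k / fact k))"

definition hyp2F1_term :: "complex \<Rightarrow> complex \<Rightarrow> complex \<Rightarrow> complex \<Rightarrow> nat \<Rightarrow> complex" where
  "hyp2F1_term a b c z n = pochhammer a n * pochhammer b n / pochhammer c n * (z ^ n / fact n)"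

definition hyp2F1 :: "complex \<Rightarrow> complex \<Rightarrow> complex \<Rightarrow> complex \<Rightarrow> complex" where
  "hyp2F1 a b c z = (\<Sum>n. hyp2F1_term a b c z n)"

definition laguerre :: "nat \<Rightarrow> complex \<Rightarrow> complex \<Rightarrow> complex" where
  "laguerre n a x = pochhammer (a + 1) n / fact n * hyp1F1 (- of_nat n) (a + 1) x"

definition laguerre_term ::
    "complex \<Rightarrow> complex \<Rightarrow> complex \<Rightarrow> complex \<Rightarrow> nat \<Rightarrow> nat \<Rightarrow> complex" where
  "laguerre_term p p' x y m n =
     pochhammer p (m + n) * pochhammer p' (m + n) * (-1) ^ n * x ^ (m + n)
       / (pochhammer p m * pochhammer p' n)
       * laguerre m (p - 1) (- y) * laguerre n (p' - 1) y"

text \<open>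
  The two standard meanings of a value of a double series: unconditional summation over all
  pairs, and summation as a power series in $x$, where the finitely many terms with
  $m + n = N$ are collected first. For fixed $y$ the terms of \<^const>\<open>laguerre_term\<close>
  contain the factor $(p + m, n) (p' + n, m)$, which grows factorially, so that for
  $x \neq 0$ unconditional summation can be expected to fail and the identity has its content
  in the second meaning.
\<close>

definition double_sums_diag :: "(nat \<Rightarrow> nat \<Rightarrow> complex) \<Rightarrow> complex \<Rightarrow> bool" where
  "double_sums_diag f s \<longleftrightarrow> (\<lambda>N. \<Sum>m\<le>N. f m (N - m)) sums s"

end

theory Submission
  imports Defs "HOL-Complex_Analysis.Complex_Analysis"
begin

text \<open>
  The generating function in \<open>t\<close> of \<open>L\<^sub>m (- y) / (p, m)\<close> is \<open>exp t\<close> times a Bessel-type series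
  \<open>\<^sub>0F\<^sub>1 (p; y t)\<close>, and that of \<open>(-1)\<^sup>n L\<^sub>n (y) / (p', n)\<close> is \<open>exp (- t)\<close> times
  \<open>\<^sub>0F\<^sub>1 (p'; y t)\<close>. The exponentials cancel in the product, and Vandermonde's identity evaluates
  the coefficients of the product of the two Bessel series.

  For the closed form, put \<open>w = sqrt (1 - z)\<close>, \<open>K = ((1 + w) / 2)\<^sup>e\<close> and \<open>G = K / w\<close> with
  \<open>e = 2 - p - p'\<close>. Then \<open>K\<close> and \<open>G\<close> satisfy a linear first-order system of differential equations,
  and eliminating the coefficients of \<open>K\<close> leaves the hypergeometric recurrence for those of \<open>G\<close>.
  Abel's limit theorem extends the identity to all points of convergence on the unit circle and
  rules out convergence at 1 (and thus outside the closed disc).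
\<close>

section \<open>Laguerre polynomials as finite sums and their generating functions\<close>

lemma pochhammer_neg_of_nat:
  assumes "k \<le> n"
  shows "pochhammer (- of_nat n :: 'a :: field_char_0) k = (-1) ^ k * (fact n / fact (n - k))"
proof -
  have "(of_nat n :: 'a) gchoose k = fact n / (fact k * fact (n - k))"
    using assms by (simp add: binomial_gbinomial [symmetric] binomial_fact)
  then have "(-1) ^ k * pochhammer (- of_nat n :: 'a) k = fact n / fact (n - k)"
    by (simp add: gbinomial_pochhammer field_simps)
  moreover have "(-1) ^ k * ((-1) ^ k * pochhammer (- of_nat n :: 'a) k) = pochhammer (- of_nat n) k"
    by (simp flip: mult.assoc power_add)
  ultimately show ?thesis
    by metis
qed

text \<open>The series terminates because \<open>(-n, k)\<close> vanishes for \<open>k > n\<close>;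
  the \<open>n!\<close> left over from \<open>(-n, k)\<close> cancels the \<open>1/n!\<close> of the
  definition.\<close>

lemma laguerre_eq_sum:
  "laguerre n (q - 1) z =
     pochhammer q n * (\<Sum>k\<le>n. (- z) ^ k / (fact k * pochhammer q k * fact (n - k)))"
proof -
  have "hyp1F1 (- of_nat n) q z =
      (\<Sum>k\<le>n. pochhammer (- of_nat n) k / pochhammer q k * (z ^ k / fact k))"
    unfolding hyp1F1_def by (rule suminf_finite) (auto simp: pochhammer_of_nat_eq_0_iff)
  also have "\<dots> = (\<Sum>k\<le>n. fact n * ((- z) ^ k / (fact k * pochhammer q k * fact (n - k))))"
  proof (rule sum.cong)
    fix k assume "k \<in> {..n}"
    then show "pochhammer (- of_nat n) k / pochhammer q k * (z ^ k / fact k) =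
        fact n * ((- z) ^ k / (fact k * pochhammer q k * fact (n - k)))"
      by (simp add: pochhammer_neg_of_nat power_minus [of z] mult_ac)
  qed simp
  finally show ?thesis
    by (simp only: laguerre_def diff_add_cancel flip: sum_distrib_left) simp
qed

text \<open>This is \<open>0F1(q; z t)\<close> as a formal series in \<open>t\<close>. The argument
  \<open>z\<close> sits in the coefficients, so the products below raise no question of
  convergence.\<close>

definition bessel_fps :: "complex \<Rightarrow> complex \<Rightarrow> complex fps" where
  "bessel_fps q z = Abs_fps (\<lambda>n. z ^ n / (fact n * pochhammer q n))"

text \<open>The Cauchy product reproduces the sum in \<open>laguerre_eq_sum\<close>. The parameter
  \<open>c\<close> serves both Laguerre factors: \<open>c = 1, z = -y\<close> and
  \<open>c = -1, z = y\<close> lead to the same Bessel argument \<open>y\<close>, with opposite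
  exponentials.\<close>

lemma bessel_fps_times_exp_nth:
  assumes "pochhammer q n \<noteq> 0"
  shows "fps_nth (bessel_fps q (- (c * z)) * fps_exp c) n = c ^ n * (laguerre n (q - 1) z / pochhammer q n)"
proof -
  have "fps_nth (bessel_fps q (- (c * z)) * fps_exp c) n =
      (\<Sum>k\<le>n. c ^ n * ((- z) ^ k / (fact k * pochhammer q k * fact (n - k))))"
    unfolding fps_mult_nth atMost_atLeast0
  proof (rule sum.cong)
    fix k assume "k \<in> {0..n}"
    then have "c ^ n = c ^ k * c ^ (n - k)"
      by (simp flip: power_add)
    moreover have "(- (c * z)) ^ k = c ^ k * (- z) ^ k"
      by (simp flip: power_mult_distrib)
    ultimately show "fps_nth (bessel_fps q (- (c * z))) k * fps_nth (fps_exp c) (n - k) =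
        c ^ n * ((- z) ^ k / (fact k * pochhammer q k * fact (n - k)))"
      by (simp add: bessel_fps_def)
  qed simp
  then show ?thesis
    using assms by (simp only: laguerre_eq_sum flip: sum_distrib_left) simp
qed

section \<open>Diagonal sums of the double series\<close>

text \<open>Splitting \<open>(p, n)\<close> after \<open>k\<close> factors and \<open>(q, n)\<close>
  after \<open>n - k\<close> factors cancels the denominators. What remains are binomial
  coefficients whose upper entries \<open>q + n - 1\<close> and \<open>p + n - 1\<close> do not
  depend on \<open>k\<close>, so Vandermonde applies.\<close>

lemma sum_inverse_pochhammer_mult:
  fixes p q :: "'a :: field_char_0"
  assumes p: "\<And>k. pochhammer p k \<noteq> 0" and q: "\<And>k. pochhammer q k \<noteq> 0"
  shows "pochhammer p n * pochhammer q n *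
      (\<Sum>k\<le>n. 1 / (fact k * pochhammer p k) * (1 / (fact (n - k) * pochhammer q (n - k)))) =
      pochhammer (p + q - 1 + of_nat n) n / fact n"
proof -
  have "pochhammer p n * pochhammer q n *
      (1 / (fact k * pochhammer p k) * (1 / (fact (n - k) * pochhammer q (n - k)))) =
      ((q + of_nat n - 1) gchoose k) * ((p + of_nat n - 1) gchoose (n - k))"
    if "k \<le> n" for k
  proof -
    have "pochhammer p n = pochhammer p k * pochhammer (p + of_nat k) (n - k)"
      using that by (rule pochhammer_product)
    moreover have "pochhammer q n = pochhammer q (n - k) * pochhammer (q + of_nat (n - k)) k"
      using pochhammer_product [of "n - k" n q] that by simp
    ultimately show ?thesis
      using p q that by (simp add: gbinomial_pochhammer' of_nat_diff algebra_simps)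
  qed
  then have "pochhammer p n * pochhammer q n *
      (\<Sum>k\<le>n. 1 / (fact k * pochhammer p k) * (1 / (fact (n - k) * pochhammer q (n - k)))) =
      (\<Sum>k\<in>{0..n}. ((q + of_nat n - 1) gchoose k) * ((p + of_nat n - 1) gchoose (n - k)))"
    unfolding sum_distrib_left atMost_atLeast0 by (intro sum.cong) auto
  also have "\<dots> = (q + of_nat n - 1 + (p + of_nat n - 1)) gchoose n"
    by (rule gbinomial_Vandermonde)
  also have "\<dots> = pochhammer (p + q - 1 + of_nat n) n / fact n"
    unfolding gbinomial_pochhammer' by (simp add: algebra_simps)
  finally show ?thesis .
qed

lemma pochhammer_nonzero:
  fixes a :: "'a :: field_char_0"
  assumes "a \<notin> \<int>\<^sub>\<le>\<^sub>0"
  shows "pochhammer a n \<noteq> 0"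
  using assms by (auto simp: pochhammer_eq_0_iff)

text \<open>The duplication formula merges the two upper parameters into \<open>(c, 2n)\<close>,
  using up the \<open>4 ^ n\<close> of the argument, and \<open>(c, n)\<close> divides out.\<close>

lemma hyp2F1_term_half:
  assumes "c \<notin> \<int>\<^sub>\<le>\<^sub>0"
  shows "hyp2F1_term (c / 2) ((c + 1) / 2) c (4 * u) n = pochhammer (c + of_nat n) n / fact n * u ^ n"
proof -
  have "pochhammer c n * pochhammer (c + of_nat n) n = pochhammer c (2 * n)"
    by (simp add: mult_2 pochhammer_product')
  also have "\<dots> = 4 ^ n * pochhammer (c / 2) n * pochhammer ((c + 1) / 2) n"
    using pochhammer_double [of "c / 2" n] by (simp add: power_mult add_divide_distrib)
  finally have "4 ^ n * pochhammer (c / 2) n * pochhammer ((c + 1) / 2) n / pochhammer c n =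
      pochhammer (c + of_nat n) n"
    using pochhammer_nonzero [OF assms, of n] by (simp add: field_simps)
  then have "4 ^ n * pochhammer (c / 2) n * pochhammer ((c + 1) / 2) n / pochhammer c n * (u ^ n / fact n) =
      pochhammer (c + of_nat n) n * (u ^ n / fact n)"
    by (rule arg_cong)
  then show ?thesis
    by (simp add: hyp2F1_term_def power_mult_distrib mult_ac)
qed

text \<open>Along a diagonal the factors depending on \<open>m + n\<close> are constant. The rest is
  a coefficient of the product of the two generating functions, in which the exponentials
  cancel.\<close>

lemma sum_laguerre_term_diagonal:
  assumes p: "p \<notin> \<int>\<^sub>\<le>\<^sub>0" and p': "p' \<notin> \<int>\<^sub>\<le>\<^sub>0"
  shows "(\<Sum>m\<le>n. laguerre_term p p' x y m (n - m)) =
    pochhammer (p + p' - 1 + of_nat n) n / fact n * (x * y) ^ n"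
proof -
  note nz = pochhammer_nonzero [OF p] pochhammer_nonzero [OF p']
  let ?E = "bessel_fps p y * fps_exp 1" and ?E' = "bessel_fps p' y * fps_exp (-1)"
  have E: "fps_nth ?E m = laguerre m (p - 1) (- y) / pochhammer p m" for m
    using bessel_fps_times_exp_nth [OF nz(1), of 1 "- y" m] by simp
  have E': "fps_nth ?E' m = (-1) ^ m * (laguerre m (p' - 1) y / pochhammer p' m)" for m
    using bessel_fps_times_exp_nth [OF nz(2), of "-1" y m] by simp
  have "?E * ?E' = bessel_fps p y * bessel_fps p' y * (fps_exp 1 * fps_exp (-1))"
    by (simp only: mult_ac)
  also have "\<dots> = bessel_fps p y * bessel_fps p' y"
    by (simp flip: fps_exp_add_mult)
  finally have EE': "?E * ?E' = bessel_fps p y * bessel_fps p' y" .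
  have "(\<Sum>m\<le>n. laguerre_term p p' x y m (n - m)) =
      pochhammer p n * pochhammer p' n * x ^ n * (\<Sum>m\<le>n. fps_nth ?E m * fps_nth ?E' (n - m))"
    unfolding sum_distrib_left E E'
    by (intro sum.cong) (auto simp: laguerre_term_def)
  also have "(\<Sum>m\<le>n. fps_nth ?E m * fps_nth ?E' (n - m)) =
      fps_nth (bessel_fps p y * bessel_fps p' y) n"
    unfolding EE' [symmetric] by (simp add: fps_mult_nth atMost_atLeast0)
  also have "\<dots> = y ^ n *
      (\<Sum>k\<le>n. 1 / (fact k * pochhammer p k) * (1 / (fact (n - k) * pochhammer p' (n - k))))"
    unfolding fps_mult_nth atMost_atLeast0 sum_distrib_left
    by (intro sum.cong) (auto simp: bessel_fps_def simp flip: power_add)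
  also have "pochhammer p n * pochhammer p' n * x ^ n * \<dots> =
      pochhammer p n * pochhammer p' n *
      (\<Sum>k\<le>n. 1 / (fact k * pochhammer p k) * (1 / (fact (n - k) * pochhammer p' (n - k))))
      * (x * y) ^ n"
    by (simp add: power_mult_distrib)
  also have "\<dots> = pochhammer (p + p' - 1 + of_nat n) n / fact n * (x * y) ^ n"
    by (simp only: sum_inverse_pochhammer_mult [OF nz])
  finally show ?thesis .
qed

text \<open>Pairs are reindexed by \<open>(m + n, m)\<close>. An unconditional sum may be evaluated
  fibre by fibre, here over the finite diagonals, and the resulting sum over \<open>N\<close> is
  also a sequential one, whose value is unique.\<close>

lemma infsum_eq_diagonal_sum:
  fixes f :: "nat \<Rightarrow> nat \<Rightarrow> complex"
  assumes summable: "(\<lambda>(m, n). f m n) summable_on UNIV"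
    and diag: "double_sums_diag f s"
  shows "(\<Sum>\<^sub>\<infinity>(m, n)\<in>UNIV. f m n) = s"
proof -
  let ?S = "\<Sum>\<^sub>\<infinity>(m, n)\<in>UNIV. f m n"
  have "((\<lambda>(N, m). f m (N - m)) has_sum ?S) (SIGMA N:UNIV. {..N}) \<longleftrightarrow>
      ((\<lambda>(m, n). f m n) has_sum ?S) UNIV"
    by (rule has_sum_reindex_bij_witness
        [where i = "\<lambda>(m, n). (m + n, m)" and j = "\<lambda>(N, m). (m, N - m)"]) auto
  then have "((\<lambda>(N, m). f m (N - m)) has_sum ?S) (SIGMA N:UNIV. {..N})"
    using summable by simp
  then have "((\<lambda>N. \<Sum>m\<le>N. f m (N - m)) has_sum ?S) UNIV"
    by (rule has_sum_SigmaD) (simp add: has_sum_finite)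
  then have "(\<lambda>N. \<Sum>m\<le>N. f m (N - m)) sums ?S"
    by (rule has_sum_imp_sums)
  with diag show ?thesis
    unfolding double_sums_diag_def by (blast intro: sums_unique2)
qed

section \<open>Abel's limit theorem\<close>

lemma Abel_limit:
  fixes b :: "nat \<Rightarrow> complex"
  assumes b: "b sums s"
  shows "((\<lambda>r. \<Sum>n. b n * of_real r ^ n) \<longlongrightarrow> s) (at_left 1)"
proof -
  \<comment> \<open>The error of the partial sum of the first \<open>n\<close> terms:
    \<open>d 0 = - s\<close>, and consecutive errors differ by \<open>b n\<close>.\<close>
  define d where "d n = (\<Sum>k<n. b k) - s" for n
  have d: "d \<longlonglongrightarrow> 0"
    using b unfolding sums_def d_def by (simp add: LIM_zero)
  then obtain M where M: "\<And>n. norm (d n) \<le> M"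
    by (meson BseqE convergentI convergent_imp_Bseq)
  have M0: "0 \<le> M"
    using M [of 0] norm_ge_zero order_trans by blast
  have sd: "summable (\<lambda>n. d n * of_real r ^ n)" if "0 < r" "r < 1" for r :: real
  proof (rule summable_comparison_test')
    show "summable (\<lambda>n. M * r ^ n)"
      using that by (intro summable_mult summable_geometric) auto
    show "norm (d n * of_real r ^ n) \<le> M * r ^ n" for n
      using that M by (simp add: norm_mult norm_power mult_right_mono)
  qed
  \<comment> \<open>Summation by parts. The factor \<open>r\<close> on the left comes from the index
    shift in \<open>b n = d (Suc n) - d n\<close>.\<close>
  have eq: "of_real r * (\<Sum>n. b n * of_real r ^ n) - s = (1 - of_real r) * (\<Sum>n. d n * of_real r ^ n)"
    if r: "0 < r" "r < 1" for r :: real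
  proof -
    let ?D = "\<Sum>n. d n * of_real r ^ n"
    have "(\<lambda>n. d (Suc n) * of_real r ^ Suc n) sums (?D - d 0)"
      using summable_sums [OF sd [OF r]] by (subst sums_Suc_iff) (simp add: d_def)
    moreover have "(\<lambda>n. of_real r * (d n * of_real r ^ n)) sums (of_real r * ?D)"
      using summable_sums [OF sd [OF r]] by (rule sums_mult)
    ultimately have "(\<lambda>n. d (Suc n) * of_real r ^ Suc n - of_real r * (d n * of_real r ^ n)) sums
        (?D - d 0 - of_real r * ?D)"
      by (rule sums_diff)
    moreover have "d (Suc n) * of_real r ^ Suc n - of_real r * (d n * of_real r ^ n) =
        of_real r * (b n * of_real r ^ n)" for n
      by (simp add: d_def algebra_simps)
    ultimately have "(\<lambda>n. of_real r * (b n * of_real r ^ n)) sums (?D - d 0 - of_real r * ?D)"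
      by simp
    then have "(\<lambda>n. b n * of_real r ^ n) sums ((?D - d 0 - of_real r * ?D) / of_real r)"
      using r sums_divide [of _ _ "of_real r"] by fastforce
    then have "of_real r * (\<Sum>n. b n * of_real r ^ n) = ?D - d 0 - of_real r * ?D"
      using r by (simp add: sums_iff)
    moreover have "d 0 = - s"
      by (simp add: d_def)
    ultimately show ?thesis
      by (simp add: algebra_simps)
  qed
  have lim: "((\<lambda>r. (1 - of_real r) * (\<Sum>n. d n * of_real r ^ n)) \<longlongrightarrow> 0) (at_left (1::real))"
  proof (rule tendstoI)
    fix e :: real assume e: "e > 0"
    then obtain N where N: "\<And>n. n \<ge> N \<Longrightarrow> norm (d n) < e / 2"
      using d unfolding LIMSEQ_iff by (metis diff_zero half_gt_zero)
    have "((\<lambda>r::real. e / 2 + (1 - r) * (real N * M)) \<longlongrightarrow> e / 2 + (1 - 1) * (real N * M)) (at_left 1)"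
      by (intro tendsto_intros)
    then have "\<forall>\<^sub>F r::real in at_left 1. e / 2 + (1 - r) * (real N * M) < e"
      by (rule order_tendstoD) (use e in simp)
    moreover have "\<forall>\<^sub>F r::real in at_left 1. r \<in> {0<..<1}"
      by (rule eventually_at_left_real) simp
    ultimately show "\<forall>\<^sub>F r::real in at_left 1.
        dist ((1 - of_real r) * (\<Sum>n. d n * of_real r ^ n)) 0 < e"
    proof eventually_elim
      case (elim r)
      then have r: "0 < r" "r < 1" by auto
      \<comment> \<open>Terms below \<open>N\<close> contribute at most \<open>M\<close> each, the
        others at most \<open>e / 2\<close> times a geometric series. Multiplied by
        \<open>1 - r\<close>, the latter becomes \<open>e / 2\<close> and the former vanishes in the
        limit.\<close>
      have "norm (\<Sum>n. d n * of_real r ^ n) \<le>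
          (\<Sum>n. e / 2 * r ^ n + (if n \<in> {..<N} then M else 0))"
      proof (rule norm_suminf_le)
        show "summable (\<lambda>n. e / 2 * r ^ n + (if n \<in> {..<N} then M else 0))"
          using r by (intro summable_add summable_mult summable_geometric summable_If_finite_set) auto
        fix n
        have "norm (d n) * r ^ n \<le> e / 2 * r ^ n" if "n \<ge> N"
          using N [OF that] r by (intro mult_right_mono) auto
        moreover have "norm (d n) * r ^ n \<le> M * 1"
          using M M0 r by (intro mult_mono power_le_one) auto
        moreover have "0 \<le> e / 2 * r ^ n"
          using e r by simp
        ultimately show "norm (d n * of_real r ^ n) \<le> e / 2 * r ^ n + (if n \<in> {..<N} then M else 0)"
          using r by (auto simp: norm_mult norm_power)
      qed
      also have "\<dots> = e / 2 * (1 / (1 - r)) + real N * M"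
      proof -
        have "(\<lambda>n. e / 2 * r ^ n + (if n \<in> {..<N} then M else 0)) sums
            (e / 2 * (1 / (1 - r)) + (\<Sum>n\<in>{..<N}. M))"
          using r by (intro sums_add sums_mult geometric_sums sums_If_finite_set) auto
        then show ?thesis
          by (simp add: sums_iff)
      qed
      finally have "(1 - r) * norm (\<Sum>n. d n * of_real r ^ n) \<le>
          (1 - r) * (e / 2 * (1 / (1 - r)) + real N * M)"
        using r by (intro mult_left_mono) auto
      also have "\<dots> = e / 2 + (1 - r) * (real N * M)"
        using r by (simp add: field_simps)
      also have "\<dots> < e"
        using elim by simp
      finally have *: "(1 - r) * norm (\<Sum>n. d n * of_real r ^ n) < e" .
      have "norm (1 - of_real r :: complex) = 1 - r"
        using r by (metis abs_of_nonneg diff_ge_0_iff_ge less_imp_le norm_of_real of_real_1 of_real_diff)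
      with * show ?case
        by (simp add: norm_mult)
    qed
  qed
  have ev: "\<forall>\<^sub>F r::real in at_left 1. r \<in> {0<..<1}"
    by (rule eventually_at_left_real) simp
  have "((\<lambda>r. ((1 - of_real r) * (\<Sum>n. d n * of_real r ^ n) + s) / of_real r) \<longlongrightarrow> (0 + s) / of_real 1)
      (at_left (1::real))"
    by (intro tendsto_intros lim) simp
  moreover have "\<forall>\<^sub>F r::real in at_left 1.
      ((1 - of_real r) * (\<Sum>n. d n * of_real r ^ n) + s) / of_real r = (\<Sum>n. b n * of_real r ^ n)"
    using ev by eventually_elim (simp flip: eq)
  ultimately show ?thesis
    by (simp add: filterlim_cong)
qed

section \<open>The closed form and its differential equations\<close>

text \<open>\<open>alg_num\<close> and \<open>alg_fun\<close> are \<open>K\<close> and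
  \<open>G\<close> of the overview, on principal branches.\<close>

definition alg_num :: "complex \<Rightarrow> complex \<Rightarrow> complex" where
  "alg_num e z = ((1 + csqrt (1 - z)) / 2) powr e"

definition alg_fun :: "complex \<Rightarrow> complex \<Rightarrow> complex" where
  "alg_fun e z = alg_num e z / csqrt (1 - z)"

text \<open>This keeps the base of the power in \<open>alg_num\<close> nonzero and off the branch
  cut.\<close>

lemma Re_half_one_plus_csqrt_pos: "0 < Re ((1 + csqrt z) / 2)"
proof -
  have "0 \<le> Re (csqrt z)"
    by (rule Re_csqrt)
  then show ?thesis
    by (simp del: csqrt.sel)
qed

lemma one_minus_notin_nonpos_Reals:
  assumes "Re z < 1"
  shows "1 - z \<notin> \<real>\<^sub>\<le>\<^sub>0"
  using assms by (auto simp: complex_nonpos_Reals_iff)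

lemma Re_pos_notin_nonpos_Reals:
  assumes "0 < Re z"
  shows "z \<notin> \<real>\<^sub>\<le>\<^sub>0"
  using assms by (auto simp: complex_nonpos_Reals_iff)

lemma has_field_derivative_alg_num:
  assumes "Re z < 1"
  shows "(alg_num e has_field_derivative
           - (e / 2) * alg_fun e z / (1 + csqrt (1 - z))) (at z)"
proof -
  let ?w = "csqrt (1 - z)"
  note z = one_minus_notin_nonpos_Reals [OF assms]
  note h = Re_pos_notin_nonpos_Reals [OF Re_half_one_plus_csqrt_pos]
  have nz: "?w \<noteq> 0" "1 + ?w \<noteq> 0"
    using z h [of "1 - z"] by auto
  have "((\<lambda>z. ((1 + csqrt (1 - z)) / 2) powr e) has_field_derivative
      e * ((1 + ?w) / 2) powr (e - 1) * (- 1 / (2 * ?w) / 2)) (at z)"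
    using z h by (auto intro!: derivative_eq_intros)
  moreover have "((1 + ?w) / 2) powr (e - 1) = alg_num e z / ((1 + ?w) / 2)"
    using nz by (simp add: alg_num_def powr_diff)
  ultimately show ?thesis
    using nz by (simp add: alg_num_def [abs_def] alg_fun_def field_simps)
qed

lemma has_field_derivative_alg_fun:
  assumes "Re z < 1"
  shows "(alg_fun e has_field_derivative
           (- (e / 2) * alg_fun e z / (1 + csqrt (1 - z)) * csqrt (1 - z)
             + alg_num e z / (2 * csqrt (1 - z))) / (1 - z)) (at z)"
proof -
  let ?w = "csqrt (1 - z)"
  note z = one_minus_notin_nonpos_Reals [OF assms]
  have nz: "?w \<noteq> 0"
    using z by auto
  have "?w * ?w = 1 - z"
    by (simp flip: power2_eq_square)
  moreover have "((\<lambda>z. alg_num e z / csqrt (1 - z)) has_field_derivative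
      (- (e / 2) * alg_fun e z / (1 + ?w) * ?w - alg_num e z * (- 1 / (2 * ?w))) / (?w * ?w)) (at z)"
    using z nz by (auto intro!: derivative_eq_intros has_field_derivative_alg_num assms)
  ultimately show ?thesis
    by (simp add: alg_fun_def [abs_def])
qed

text \<open>With \<open>w = csqrt (1 - z)\<close>, the relations
  \<open>z = (1 - w) * (1 + w)\<close> and \<open>1 - z = w * w\<close> show that the factors
  \<open>z\<close> and \<open>1 - z\<close> clear the denominators \<open>1 + w\<close> and
  \<open>w\<close>. The coefficients become polynomials in \<open>z\<close>, so they can be read off
  as recurrences.\<close>

lemma alg_ode:
  assumes "Re z < 1"
  shows "2 * (z * deriv (alg_num e) z) = e * (alg_num e z - alg_fun e z)"
    and "2 * (z * ((1 - z) * deriv (alg_fun e) z)) =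
           e * ((1 - z) * alg_fun e z - alg_num e z) + z * alg_fun e z"
proof -
  define w where "w = csqrt (1 - z)"
  note h = Re_pos_notin_nonpos_Reals [OF Re_half_one_plus_csqrt_pos]
  have nz: "w \<noteq> 0" "1 + w \<noteq> 0" "1 - z \<noteq> 0"
    using one_minus_notin_nonpos_Reals [OF assms] h [of "1 - z"] by (auto simp: w_def)
  have "1 - z = w * w"
    by (simp add: w_def flip: power2_eq_square)
  then have z: "z = (1 - w) * (1 + w)"
    by (simp add: algebra_simps)
  have K: "alg_num e z = w * alg_fun e z"
    using nz by (simp add: alg_fun_def w_def)
  \<comment> \<open>The reciprocal is kept as an atom; \<open>z * v = 1 - w\<close> then does all
    the cancelling.\<close>
  define v where "v = 1 / (1 + w)"
  have zv: "z * v = 1 - w"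
    using nz by (simp add: z v_def)
  have K': "2 * deriv (alg_num e) z = - e * (alg_fun e z * v)"
    using DERIV_imp_deriv [OF has_field_derivative_alg_num [OF assms]]
    by (simp add: v_def w_def del: distrib_left_numeral)
  have G': "2 * ((1 - z) * deriv (alg_fun e) z) = - e * (alg_fun e z * v) * w + alg_fun e z"
    using nz K
    by (simp add: v_def w_def DERIV_imp_deriv [OF has_field_derivative_alg_fun [OF assms]]
        del: distrib_left_numeral)
  have "2 * (z * deriv (alg_num e) z) = z * (2 * deriv (alg_num e) z)"
    by (simp only: mult_ac)
  also have "\<dots> = - (z * v) * (e * alg_fun e z)"
    by (simp only: K' mult_ac mult_minus_left mult_minus_right)
  also have "\<dots> = e * (alg_num e z - alg_fun e z)"
    unfolding zv K by (simp add: algebra_simps)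
  finally show "2 * (z * deriv (alg_num e) z) = e * (alg_num e z - alg_fun e z)" .
  have "2 * (z * ((1 - z) * deriv (alg_fun e) z)) = z * (2 * ((1 - z) * deriv (alg_fun e) z))"
    by (simp only: mult_ac)
  also have "\<dots> = - (z * v) * (e * alg_fun e z) * w + z * alg_fun e z"
    unfolding G' by (simp only: distrib_left mult_ac mult_minus_left mult_minus_right)
  also have "- (z * v) * (e * alg_fun e z) * w = e * (w * w * alg_fun e z - w * alg_fun e z)"
    unfolding zv by (simp add: algebra_simps)
  also have "\<dots> = e * ((1 - z) * alg_fun e z - alg_num e z)"
    by (simp only: K \<open>1 - z = w * w\<close>)
  finally show "2 * (z * ((1 - z) * deriv (alg_fun e) z)) =
           e * ((1 - z) * alg_fun e z - alg_num e z) + z * alg_fun e z" .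
qed

lemma alg_holomorphic:
  "alg_num e holomorphic_on {z. Re z < 1}" "alg_fun e holomorphic_on {z. Re z < 1}"
  unfolding holomorphic_on_def field_differentiable_def
  by (blast intro: has_field_derivative_at_within
      has_field_derivative_alg_num has_field_derivative_alg_fun)+

section \<open>Taylor coefficients of the closed form\<close>

lemma pochhammer_half_Suc_mult:
  fixes c :: complex
  shows "4 * (pochhammer (c / 2) (Suc n) * pochhammer ((c + 1) / 2) (Suc n)) =
    (c + 2 * of_nat n) * (c + 2 * of_nat n + 1) * (pochhammer (c / 2) n * pochhammer ((c + 1) / 2) n)"
proof -
  have "4 * (pochhammer (c / 2) (Suc n) * pochhammer ((c + 1) / 2) (Suc n)) =
      (2 * (c / 2 + of_nat n)) * (2 * ((c + 1) / 2 + of_nat n)) *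
      (pochhammer (c / 2) n * pochhammer ((c + 1) / 2) n)"
    by (simp only: pochhammer_Suc mult_ac) simp
  also have "2 * (c / 2 + of_nat n) = c + 2 * of_nat n"
    by simp
  also have "2 * ((c + 1) / 2 + of_nat n) = c + 2 * of_nat n + 1"
    by simp
  finally show ?thesis .
qed

text \<open>This turns differential equations valid near 0 into identities of formal power
  series.\<close>

lemma fps_eq_if_eventually_eq:
  fixes F G :: "complex fps"
  assumes "f has_fps_expansion F" "g has_fps_expansion G" "\<forall>\<^sub>F z in nhds 0. f z = g z"
  shows "F = G"
  using fps_expansion_unique_complex [OF _ assms(2)] has_fps_expansion_cong [OF assms(3) refl] assms(1)
  by blast

lemma alg_fun_fps_nth:
  assumes "1 - e \<notin> \<int>\<^sub>\<le>\<^sub>0"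
  shows "fps_nth (fps_expansion (alg_fun e) 0) n * z ^ n =
    hyp2F1_term ((1 - e) / 2) ((2 - e) / 2) (1 - e) z n"
proof -
  define K G where "K = fps_expansion (alg_num e) 0" and "G = fps_expansion (alg_fun e) 0"
  have op: "open {z. Re z < 1}"
    by (rule open_halfspace_Re_lt)
  have K: "alg_num e has_fps_expansion K" and G: "alg_fun e has_fps_expansion G"
    unfolding K_def G_def by (rule has_fps_expansion_fps_expansion [OF op _ alg_holomorphic(1)], simp)
      (rule has_fps_expansion_fps_expansion [OF op _ alg_holomorphic(2)], simp)
  have ev: "\<forall>\<^sub>F z in nhds 0. Re z < 1"
    using eventually_nhds_in_open [OF op] by simp
  have eqK: "fps_const 2 * (fps_X * fps_deriv K) = fps_const e * (K - G)"
  proof (rule fps_eq_if_eventually_eq)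
    show "\<forall>\<^sub>F z in nhds 0. 2 * (z * deriv (alg_num e) z) = e * (alg_num e z - alg_fun e z)"
      using ev by eventually_elim (rule alg_ode)
  qed (intro fps_expansion_intros K G)+
  have eqG: "fps_const 2 * (fps_X * ((1 - fps_X) * fps_deriv G)) =
      fps_const e * ((1 - fps_X) * G - K) + fps_X * G"
  proof (rule fps_eq_if_eventually_eq)
    show "\<forall>\<^sub>F z in nhds 0. 2 * (z * ((1 - z) * deriv (alg_fun e) z)) =
        e * ((1 - z) * alg_fun e z - alg_num e z) + z * alg_fun e z"
      using ev by eventually_elim (rule alg_ode)
  qed (intro fps_expansion_intros K G)+
  let ?g = "fps_nth G" and ?k = "fps_nth K"
  have recK: "(2 * of_nat (Suc n) - e) * ?k (Suc n) = - e * ?g (Suc n)" for n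
    using arg_cong [OF eqK, of "\<lambda>F. fps_nth F (Suc n)"]
    by (simp add: numeral_fps_const algebra_simps)
  have recG: "(2 * of_nat (Suc n) - e) * ?g (Suc n) = (2 * of_nat n + 1 - e) * ?g n - e * ?k (Suc n)" for n
    using arg_cong [OF eqG, of "\<lambda>F. fps_nth F (Suc n)"]
    by (cases n) (simp_all add: numeral_fps_const algebra_simps)
  have rec: "4 * of_nat (Suc n) * (1 - e + of_nat n) * ?g (Suc n) =
      (1 - e + 2 * of_nat n) * (1 - e + 2 * of_nat n + 1) * ?g n" for n
  proof -
    \<comment> \<open>Multiplying the recurrence for \<open>G\<close> by \<open>a\<close> lets
      \<open>recK\<close> replace the coefficient of \<open>K\<close>. The factor
      \<open>a * a - e * e\<close> splits as a difference of squares, and \<open>a = b + 1\<close>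
      gives the hypergeometric form.\<close>
    define a b where "a = 2 * of_nat (Suc n) - e" and "b = 2 * of_nat n + 1 - e"
    have "a * ?g (Suc n) = b * ?g n - e * ?k (Suc n)"
      using recG [of n] by (simp only: a_def b_def)
    then have "a * (a * ?g (Suc n)) = a * (b * ?g n - e * ?k (Suc n))"
      by (rule arg_cong)
    also have "\<dots> = a * b * ?g n - e * (a * ?k (Suc n))"
      by (simp add: algebra_simps)
    also have "a * ?k (Suc n) = - e * ?g (Suc n)"
      using recK [of n] by (simp only: a_def)
    finally have "(a * a - e * e) * ?g (Suc n) = a * b * ?g n"
      by (simp add: algebra_simps)
    moreover have "a * a - e * e = 4 * of_nat (Suc n) * (1 - e + of_nat n)"
      by (simp add: a_def algebra_simps)
    ultimately show ?thesis
      by (simp add: a_def b_def algebra_simps)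
  qed
  have "?g n = pochhammer ((1 - e) / 2) n * pochhammer ((2 - e) / 2) n / pochhammer (1 - e) n / fact n"
  proof (induction n)
    case 0
    show ?case
      by (simp add: G_def fps_expansion_def alg_fun_def alg_num_def)
  next
    case (Suc n)
    let ?P = "pochhammer ((1 - e) / 2)" and ?Q = "pochhammer ((2 - e) / 2)"
    let ?d = "4 * of_nat (Suc n) * (1 - e + of_nat n)"
    have nz: "pochhammer (1 - e) n \<noteq> 0" "1 - e + of_nat n \<noteq> 0"
      using pochhammer_nonzero [OF assms, of n] pochhammer_nonzero [OF assms, of "Suc n"]
      by (auto simp: pochhammer_Suc)
    have "?d * ?g (Suc n) = (1 - e + 2 * of_nat n) * (1 - e + 2 * of_nat n + 1) * (?P n * ?Q n)
        / (pochhammer (1 - e) n * fact n)"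
      by (simp only: rec Suc.IH) simp
    also have "(1 - e + 2 * of_nat n) * (1 - e + 2 * of_nat n + 1) * (?P n * ?Q n) =
        4 * (?P (Suc n) * ?Q (Suc n))"
      using pochhammer_half_Suc_mult [of "1 - e" n] by simp
    finally have eq: "?d * ?g (Suc n) = 4 * (?P (Suc n) * ?Q (Suc n)) / (pochhammer (1 - e) n * fact n)" .
    have "?d \<noteq> 0"
      using nz by (simp del: of_nat_Suc)
    then have "?g (Suc n) = ?d * ?g (Suc n) / ?d"
      by (rule nonzero_mult_div_cancel_left [symmetric])
    also have "\<dots> = ?P (Suc n) * ?Q (Suc n) / (pochhammer (1 - e) n * (1 - e + of_nat n))
        / (of_nat (Suc n) * fact n)"
    proof -
      have "4 * X / (Y * F) / (4 * N * q) = X / (Y * q) / (N * F)" for X Y F N q :: complex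
        by simp
      then show ?thesis
        unfolding eq .
    qed
    finally show ?case
      by (simp only: pochhammer_Suc [of "1 - e"] fact_Suc of_nat_mult of_nat_fact)
  qed
  then show ?thesis
    by (simp add: G_def hyp2F1_term_def)
qed

section \<open>Radial limits and the points of convergence\<close>

lemma tendsto_radial:
  fixes f :: "complex \<Rightarrow> complex"
  assumes "isCont f z"
  shows "((\<lambda>r. f (of_real r * z)) \<longlongrightarrow> f z) (at_left 1)"
proof -
  have "((\<lambda>r. of_real r * z) \<longlongrightarrow> of_real 1 * z) (at_left 1)"
    by (intro tendsto_intros)
  then show ?thesis
    using isCont_tendsto_compose [OF assms] by simp
qed

text \<open>The open unit disc lies in the half-plane \<open>Re z < 1\<close> of holomorphy, so the
  Taylor series at 0 has radius at least 1.\<close>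

lemma alg_fun_sums_inside:
  assumes "1 - e \<notin> \<int>\<^sub>\<le>\<^sub>0" "norm z < 1"
  shows "hyp2F1_term ((1 - e) / 2) ((2 - e) / 2) (1 - e) z sums alg_fun e z"
proof -
  have hol: "alg_fun e holomorphic_on eball 0 (ereal 1)"
    by (rule holomorphic_on_subset [OF alg_holomorphic(2)])
      (auto intro: order_le_less_trans [OF complex_Re_le_cmod])
  have "(\<lambda>n. fps_nth (fps_expansion (alg_fun e) 0) n * z ^ n) sums eval_fps (fps_expansion (alg_fun e) 0) z"
    using assms by (intro sums_eval_fps less_le_trans [OF _ conv_radius_fps_expansion [OF hol]]) simp
  also have "eval_fps (fps_expansion (alg_fun e) 0) z = alg_fun e z"
    using eval_fps_expansion' [OF hol] assms by simp
  finally show ?thesis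
    by (simp add: alg_fun_fps_nth [OF assms(1)])
qed

text \<open>Scaling \<open>z\<close> by \<open>r < 1\<close> multiplies the \<open>n\<close>-th term
  by \<open>r ^ n\<close> and moves the point into the open disc, where the sum is known; Abel's
  theorem gives the limit.\<close>

lemma alg_fun_tendsto_radial:
  assumes e: "1 - e \<notin> \<int>\<^sub>\<le>\<^sub>0" and z: "norm z \<le> 1"
    and s: "hyp2F1_term ((1 - e) / 2) ((2 - e) / 2) (1 - e) z sums s"
  shows "((\<lambda>r. alg_fun e (of_real r * z)) \<longlongrightarrow> s) (at_left 1)"
proof -
  let ?t = "hyp2F1_term ((1 - e) / 2) ((2 - e) / 2) (1 - e)"
  have "((\<lambda>r. \<Sum>n. ?t z n * of_real r ^ n) \<longlongrightarrow> s) (at_left 1)"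
    by (rule Abel_limit [OF s])
  moreover have "\<forall>\<^sub>F r::real in at_left 1. (\<Sum>n. ?t z n * of_real r ^ n) = alg_fun e (of_real r * z)"
  proof -
    have "\<forall>\<^sub>F r::real in at_left 1. r \<in> {0<..<1}"
      by (rule eventually_at_left_real) simp
    then show ?thesis
    proof eventually_elim
      case (elim r)
      have "norm (of_real r * z) \<le> r * 1"
        using elim z by (simp add: norm_mult mult_left_le)
      then have "?t (of_real r * z) sums alg_fun e (of_real r * z)"
        using elim by (intro alg_fun_sums_inside e) auto
      moreover have "?t (of_real r * z) = (\<lambda>n. ?t z n * of_real r ^ n)"
        by (simp add: fun_eq_iff hyp2F1_term_def power_mult_distrib)
      ultimately have "(\<lambda>n. ?t z n * of_real r ^ n) sums alg_fun e (of_real r * z)"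
        by (simp only:)
      then show ?case
        by (rule sums_unique [symmetric])
    qed
  qed
  ultimately show ?thesis
    by (simp add: filterlim_cong)
qed

text \<open>
  As \<open>r \<rightarrow> 1\<close> from below, \<open>alg_fun e r\<close> blows up like \<open>1 / sqrt (1 - r)\<close>, so the series cannot
  converge at 1 by Abel's theorem.
\<close>
lemma not_summable_at_1:
  assumes e: "1 - e \<notin> \<int>\<^sub>\<le>\<^sub>0"
  shows "\<not> summable (hyp2F1_term ((1 - e) / 2) ((2 - e) / 2) (1 - e) 1)"
proof
  assume "summable (hyp2F1_term ((1 - e) / 2) ((2 - e) / 2) (1 - e) 1)"
  then obtain s where s: "hyp2F1_term ((1 - e) / 2) ((2 - e) / 2) (1 - e) 1 sums s"
    by (auto simp: summable_def)
  have lim: "((\<lambda>r. alg_fun e (of_real r)) \<longlongrightarrow> s) (at_left (1::real))"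
    using alg_fun_tendsto_radial [OF e _ s] by simp
  have ev: "\<forall>\<^sub>F r::real in at_left 1. r \<in> {0<..<1}"
    by (rule eventually_at_left_real) simp
  have "((\<lambda>r::real. complex_of_real (sqrt (1 - r))) \<longlongrightarrow> of_real (sqrt (1 - 1))) (at_left 1)"
    by (intro tendsto_intros)
  moreover have "\<forall>\<^sub>F r::real in at_left 1. complex_of_real (sqrt (1 - r)) = csqrt (1 - of_real r)"
    using ev by eventually_elim (simp flip: of_real_sqrt of_real_diff)
  ultimately have w: "((\<lambda>r. csqrt (1 - of_real r)) \<longlongrightarrow> 0) (at_left (1::real))"
    by (simp add: filterlim_cong)
  \<comment> \<open>The blow-up is expressed by finite limits: \<open>alg_num\<close> tends to the
    nonzero \<open>(1 / 2) powr e\<close>, but as \<open>alg_fun\<close> times a vanishing root it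
    would tend to 0.\<close>
  have "((\<lambda>r. alg_num e (of_real r)) \<longlongrightarrow> ((1 + 0) / 2) powr e) (at_left (1::real))"
    unfolding alg_num_def by (intro tendsto_intros w) (auto simp: complex_nonpos_Reals_iff)
  moreover have "((\<lambda>r. alg_num e (of_real r)) \<longlongrightarrow> s * 0) (at_left (1::real))"
  proof -
    have "((\<lambda>r. alg_fun e (of_real r) * csqrt (1 - of_real r)) \<longlongrightarrow> s * 0) (at_left (1::real))"
      by (intro tendsto_intros lim w)
    moreover have "\<forall>\<^sub>F r::real in at_left 1.
        alg_fun e (of_real r) * csqrt (1 - of_real r) = alg_num e (of_real r)"
      using ev by eventually_elim (simp add: alg_fun_def)
    ultimately show ?thesis
      by (simp add: filterlim_cong)
  qed
  ultimately have "((1 + 0) / 2 :: complex) powr e = s * 0"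
    by (rule tendsto_unique [rotated]) simp
  then show False
    by simp
qed

text \<open>Convergence beyond the closed unit disc would force convergence at 1, so
  \<open>norm z \<le> 1\<close> and \<open>z \<noteq> 1\<close>. Then \<open>Re z < 1\<close>, where
  \<open>alg_fun\<close> is continuous, and the two radial limits must agree.\<close>

lemma hyp2F1_eq_alg_fun:
  assumes e: "1 - e \<notin> \<int>\<^sub>\<le>\<^sub>0"
    and summable: "summable (hyp2F1_term ((1 - e) / 2) ((2 - e) / 2) (1 - e) z)"
  shows "hyp2F1 ((1 - e) / 2) ((2 - e) / 2) (1 - e) z = alg_fun e z"
proof -
  let ?t = "hyp2F1_term ((1 - e) / 2) ((2 - e) / 2) (1 - e)"
  have "z \<noteq> 1"
    using not_summable_at_1 [OF e] summable by metis
  have "norm z \<le> 1"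
  proof (rule ccontr)
    assume "\<not> norm z \<le> 1"
    then have "norm (1 :: complex) < norm z"
      by simp
    moreover have "summable (\<lambda>n. fps_nth (fps_expansion (alg_fun e) 0) n * z ^ n)"
      unfolding alg_fun_fps_nth [OF e] by (rule summable)
    ultimately have "summable (\<lambda>n. fps_nth (fps_expansion (alg_fun e) 0) n * 1 ^ n)"
      by (rule powser_inside [rotated])
    then have "summable (hyp2F1_term ((1 - e) / 2) ((2 - e) / 2) (1 - e) 1)"
      unfolding alg_fun_fps_nth [OF e] .
    with not_summable_at_1 [OF e] show False
      by contradiction
  qed
  have "Re z < 1"
  proof (rule ccontr)
    assume "\<not> Re z < 1"
    then have "Re z = 1" "norm z = 1"
      using \<open>norm z \<le> 1\<close> complex_Re_le_cmod [of z] by auto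
    then have "Im z = 0"
      by (simp add: cmod_def)
    with \<open>Re z = 1\<close> \<open>z \<noteq> 1\<close> show False
      by (simp add: complex_eq_iff)
  qed
  have "((\<lambda>r. alg_fun e (of_real r * z)) \<longlongrightarrow> hyp2F1 ((1 - e) / 2) ((2 - e) / 2) (1 - e) z) (at_left 1)"
    unfolding hyp2F1_def by (rule alg_fun_tendsto_radial [OF e \<open>norm z \<le> 1\<close> summable_sums [OF summable]])
  moreover have "((\<lambda>r. alg_fun e (of_real r * z)) \<longlongrightarrow> alg_fun e z) (at_left 1)"
    by (rule tendsto_radial [OF DERIV_isCont [OF has_field_derivative_alg_fun [OF \<open>Re z < 1\<close>]]])
  ultimately show ?thesis
    by (rule tendsto_unique [rotated]) simp
qed

theorem mainTheorem4:
  fixes p p' x y :: complex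
  assumes "p \<notin> \<int>\<^sub>\<le>\<^sub>0" and "p' \<notin> \<int>\<^sub>\<le>\<^sub>0" and "p + p' - 1 \<notin> \<int>\<^sub>\<le>\<^sub>0"
    and "summable (hyp2F1_term ((p + p' - 1) / 2) ((p + p') / 2) (p + p' - 1) (4 * x * y))"
  shows "double_sums_diag (laguerre_term p p' x y)
           (hyp2F1 ((p + p' - 1) / 2) ((p + p') / 2) (p + p' - 1) (4 * x * y))
       \<and> ((\<lambda>(m, n). laguerre_term p p' x y m n) summable_on UNIV \<longrightarrow>
            (\<Sum>\<^sub>\<infinity>(m, n)\<in>UNIV. laguerre_term p p' x y m n)
              = hyp2F1 ((p + p' - 1) / 2) ((p + p') / 2) (p + p' - 1) (4 * x * y))
       \<and> hyp2F1 ((p + p' - 1) / 2) ((p + p') / 2) (p + p' - 1) (4 * x * y)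
           = (1 - 4 * x * y) powr (- 1 / 2)
             * (1 / 2 + 1 / 2 * (1 - 4 * x * y) powr (1 / 2)) powr (2 - p - p')"
proof (intro conjI impI)
  let ?F = "hyp2F1 ((p + p' - 1) / 2) ((p + p') / 2) (p + p' - 1) (4 * x * y)"
  \<comment> \<open>The diagonal sums are the hypergeometric terms themselves, with
    \<open>c = p + p' - 1\<close> and \<open>u = x * y\<close>; diagonal summability is thus the
    assumed convergence.\<close>
  have "hyp2F1_term ((p + p' - 1) / 2) ((p + p') / 2) (p + p' - 1) (4 * x * y) =
      (\<lambda>n. \<Sum>m\<le>n. laguerre_term p p' x y m (n - m))"
    using hyp2F1_term_half [OF assms(3), of "x * y"]
    by (intro ext) (simp add: sum_laguerre_term_diagonal [OF assms(1,2)] mult.assoc)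
  then show diag: "double_sums_diag (laguerre_term p p' x y) ?F"
    using summable_sums [OF assms(4)] unfolding double_sums_diag_def hyp2F1_def by (simp only:)
  show "(\<Sum>\<^sub>\<infinity>(m, n)\<in>UNIV. laguerre_term p p' x y m n) = ?F"
    if "(\<lambda>(m, n). laguerre_term p p' x y m n) summable_on UNIV"
    using that diag by (rule infsum_eq_diagonal_sum)
  \<comment> \<open>With \<open>e = 2 - p - p'\<close>, the parameters \<open>1 - e\<close> and
    \<open>2 - e\<close> are \<open>p + p' - 1\<close> and \<open>p + p'\<close>.\<close>
  have "?F = alg_fun (2 - p - p') (4 * x * y)"
    using hyp2F1_eq_alg_fun [of "2 - p - p'" "4 * x * y"] assms(3,4) by (simp add: add.commute diff_diff_eq2)
  also have "\<dots> = (1 - 4 * x * y) powr - (1 / 2)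
      * ((1 + (1 - 4 * x * y) powr (1 / 2)) / 2) powr (2 - p - p')"
    by (simp only: alg_fun_def alg_num_def csqrt_conv_powr powr_minus divide_inverse mult.commute)
  finally show "?F = (1 - 4 * x * y) powr (- 1 / 2)
      * (1 / 2 + 1 / 2 * (1 - 4 * x * y) powr (1 / 2)) powr (2 - p - p')"
    by (simp add: add_divide_distrib)
qed

end
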